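(* Let $f \in \mathbb{R}[X,Y]$ with $f \ge 0$ on $[0,1]\times\mathbb{R}$, let $m = \deg_Y f$ and $d = \deg_X f$, and suppose that $f$ is fully $m$-ic on $[0,1]$, that $f$ has a finite number of zeros in $[0,1]\times\mathbb{R}$, all of them lying on $\{0,1\}\times\mathbb{R}$, and that $\frac{\partial f}{\partial X}$ does not vanish at any of them. Then there is $N \in \mathbb{N}_0$ such that for every $0 \le j \le N+d$, $b_j \ge 0$ on $C$.
   Context: For $f \in \mathbb{R}[X,Y]$ with $m = \deg_Y f$, $f$ is fully $m$-ic on $[0,1]$ if for every $x \in [0,1]$ the polynomial $f(x,Y) \in \mathbb{R}[Y]$ has degree $m$. With $m = \deg_Y f$ and $d = \deg_X f$, write $f = \sum_{0 \le i \le m}\sum_{0 \le j \le d} a_{ji}X^jY^i$ and define $$F = \sum_{0 \le i \le m}\sum_{0 \le j \le d} a_{ji}X^j(W+X)^{d-j}Y^iZ^{m-i} \in \mathbb{R}[W,X,Y,Z].$$ For $N \in \mathbb{N}_0$ the polynomials $b_j \in \mathbb{R}[Y,Z]$, $0 \le j \le N+d$ (depending on $N$ and $f$) are defined by $$(W+X)^N F = \sum_{0 \le j \le N+d} b_j(Y,Z)\,W^jX^{N+d-j}.$$ $C = \{(y,z) \in \mathbb{R}^2 \mid y^2+z^2 = 1\}$. *)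

theory Defs
  imports Complex_Main "HOL-Computational_Algebra.Polynomial"
begin

text \<open>
  A polynomial in two variables, such as \<open>f \<in> \<real>[X,Y]\<close>, has type \<open>real poly poly\<close>, where
  the first variable is the inner one: \<open>coeff (coeff f i) j\<close> is the coefficient of
  \<open>X\<^sup>j Y\<^sup>i\<close>. In particular \<open>deg\<^sub>Y f\<close> is \<open>degree f\<close>.
\<close>

text \<open>\<open>f(x, Y) \<in> \<real>[Y]\<close>:\<close>

definition spec_fst :: "real poly poly \<Rightarrow> real \<Rightarrow> real poly" where
  "spec_fst f x = map_poly (\<lambda>p. poly p x) f"

definition eval2 :: "real poly poly \<Rightarrow> real \<Rightarrow> real \<Rightarrow> real" where
  "eval2 f x y = poly (spec_fst f x) y"

definition degX :: "real poly poly \<Rightarrow> nat" where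
  "degX f = Max ((\<lambda>i. degree (coeff f i)) ` {..degree f})"

definition pderivX :: "real poly poly \<Rightarrow> real poly poly" where
  "pderivX f = map_poly pderiv f"

text \<open>
  In the library \<open>degree 0 = 0\<close>, whereas the zero polynomial should not count as having
  degree \<open>m = 0\<close>; hence the first conjunct.
\<close>

definition fully_ic_on :: "nat \<Rightarrow> real poly poly \<Rightarrow> real set \<Rightarrow> bool" where
  "fully_ic_on m f S \<longleftrightarrow> (\<forall>x\<in>S. spec_fst f x \<noteq> 0 \<and> degree (spec_fst f x) = m)"

text \<open>
  \<open>\<real>[W,X,Y,Z]\<close> is represented as \<open>\<real>[Y][Z][X][W]\<close>, with \<open>Y\<close> the innermost and \<open>W\<close> the
  outermost variable. Thus the coefficient of \<open>W\<^sup>j X\<^sup>k\<close>, as an element of \<open>\<real>[Y][Z]\<close>, is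
  obtained by applying \<open>coeff\<close> twice.
\<close>

type_synonym poly4 = "real poly poly poly poly"

definition varW :: poly4 where "varW = [:0, 1:]"
definition varX :: poly4 where "varX = [:[:0, 1:]:]"
definition varZ :: poly4 where "varZ = [:[:[:0, 1:]:]:]"
definition varY :: poly4 where "varY = [:[:[:[:0, 1:]:]:]:]"

definition const4 :: "real \<Rightarrow> poly4" where
  "const4 c = [:[:[:[:c:]:]:]:]"

definition homogF :: "real poly poly \<Rightarrow> poly4" where
  "homogF f = (\<Sum>i\<le>degree f. \<Sum>j\<le>degX f.
     const4 (coeff (coeff f i) j) * varX ^ j * (varW + varX) ^ (degX f - j)
       * varY ^ i * varZ ^ (degree f - i))"

text \<open>
  The polynomials \<open>b\<^sub>j \<in> \<real>[Y,Z]\<close>, as coefficients of \<open>W\<^sup>j X\<^bsup>N+d-j\<^esup>\<close>. The lemma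
  \<open>b_poly_expansion\<close> below shows that they satisfy the equation defining them.
\<close>

definition b_poly :: "nat \<Rightarrow> real poly poly \<Rightarrow> nat \<Rightarrow> real poly poly" where
  "b_poly N f j = coeff (coeff ((varW + varX) ^ N * homogF f) j) (N + degX f - j)"

definition unit_circle :: "(real \<times> real) set" where
  "unit_circle = {(y, z). y\<^sup>2 + z\<^sup>2 = 1}"

text \<open>Homogeneity of degree \<open>n\<close> in the two outer variables:\<close>

definition homog :: "nat \<Rightarrow> 'a::comm_ring_1 poly poly \<Rightarrow> bool" where
  "homog n p \<longleftrightarrow> (\<forall>j k. coeff (coeff p j) k \<noteq> 0 \<longrightarrow> j + k = n)"

lemma homog_mult:
  assumes "homog m p" "homog n q"
  shows "homog (m + n) (p * q)"
  unfolding homog_def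
proof (intro allI impI)
  fix j k assume "coeff (coeff (p * q) j) k \<noteq> 0"
  then have "(\<Sum>i\<le>j. \<Sum>l\<le>k. coeff (coeff p i) l * coeff (coeff q (j - i)) (k - l)) \<noteq> 0"
    by (simp add: coeff_mult coeff_sum)
  then obtain i l where il: "i \<le> j" "l \<le> k"
    "coeff (coeff p i) l * coeff (coeff q (j - i)) (k - l) \<noteq> 0"
    by (elim sum.not_neutral_contains_not_neutral) auto
  then have "coeff (coeff p i) l \<noteq> 0" "coeff (coeff q (j - i)) (k - l) \<noteq> 0"
    by auto
  then have "i + l = m" "(j - i) + (k - l) = n"
    using assms unfolding homog_def by blast+
  then show "j + k = m + n" using il by linarith
qed

lemma homog_sum:
  assumes "\<And>i. i \<in> A \<Longrightarrow> homog n (g i)"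
  shows "homog n (\<Sum>i\<in>A. g i)"
  unfolding homog_def
proof (intro allI impI)
  fix j k assume "coeff (coeff (\<Sum>i\<in>A. g i) j) k \<noteq> 0"
  then have "(\<Sum>i\<in>A. coeff (coeff (g i) j) k) \<noteq> 0"
    by (simp add: coeff_sum)
  then obtain i where "i \<in> A" "coeff (coeff (g i) j) k \<noteq> 0"
    by (rule sum.not_neutral_contains_not_neutral)
  with assms show "j + k = n"
    by (simp add: homog_def)
qed

lemma homog_const: "homog 0 [:[:c:]:]"
  by (auto simp: homog_def coeff_pCons split: nat.splits)

lemma homog_power: "homog n p \<Longrightarrow> homog (k * n) (p ^ k)"
  by (induction k) (auto simp: homog_mult homog_const simp flip: pCons_one)

lemma homog_varX: "homog 1 varX"
  by (auto simp: homog_def varX_def coeff_pCons split: nat.splits)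

lemma homog_varW_varX: "homog 1 (varW + varX)"
  by (auto simp: homog_def varX_def varW_def coeff_pCons split: nat.splits)

lemma homog_homogF: "homog (degX f) (homogF f)"
  unfolding homogF_def
proof (intro homog_sum)
  fix i j assume "j \<in> {..degX f}"
  then have deg: "degX f = 0 + j * 1 + (degX f - j) * 1 + i * 0 + (degree f - i) * 0"
    by simp
  show "homog (degX f) (const4 (coeff (coeff f i) j) * varX ^ j
      * (varW + varX) ^ (degX f - j) * varY ^ i * varZ ^ (degree f - i))"
    by (subst deg, intro homog_mult homog_power homog_varX homog_varW_varX)
      (simp_all add: const4_def varY_def varZ_def homog_const)
qed

lemma homog_expansion:
  assumes "homog n p"
  shows "p = (\<Sum>j\<le>n. [:[:coeff (coeff p j) (n - j):]:] * [:0, 1:] ^ j * [:[:0, 1:]:] ^ (n - j))"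
    (is "_ = (\<Sum>j\<le>n. ?t j)")
proof (intro poly_eqI)
  fix a b
  have t: "?t j = monom (monom (coeff (coeff p j) (n - j)) (n - j)) j" for j
  proof -
    have "[:[:0, 1:]:] ^ (n - j) = [:monom (1::'a) (n - j):]"
      by (simp add: poly_const_pow monom_altdef)
    moreover have "[:0, 1:] ^ j = monom (1::'a poly) j"
      by (simp add: monom_altdef)
    ultimately show ?thesis by (simp add: smult_monom mult.commute)
  qed
  have "coeff (coeff (\<Sum>j\<le>n. ?t j) a) b
      = (\<Sum>j\<le>n. if j = a \<and> n - j = b then coeff (coeff p j) (n - j) else 0)"
    unfolding t coeff_sum by (intro sum.cong) auto
  also have "\<dots> = (\<Sum>j\<le>n. if j = a then (if n - a = b then coeff (coeff p a) b else 0) else 0)"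
    by (intro sum.cong) auto
  also have "\<dots> = (if a \<le> n \<and> n - a = b then coeff (coeff p a) b else 0)"
    by simp
  also have "\<dots> = coeff (coeff p a) b"
    using assms unfolding homog_def by (metis diff_add_inverse le_add1)
  finally show "coeff (coeff p a) b = coeff (coeff (\<Sum>j\<le>n. ?t j) a) b" ..
qed

lemma b_poly_expansion:
  "(varW + varX) ^ N * homogF f =
     (\<Sum>j\<le>N + degX f. [:[:b_poly N f j:]:] * varW ^ j * varX ^ (N + degX f - j))"
  using homog_expansion[OF homog_mult[OF homog_power[OF homog_varW_varX, of N] homog_homogF, of f]]
  unfolding b_poly_def varW_def varX_def by simp

end

theory Submission
  imports Defs "HOL-Analysis.Analysis"
begin

text \<open>
  Put \<open>n = N + d\<close> and \<open>g(x, y, z) = z\<^sup>m f(x, y / z)\<close>. Up to the factor \<open>n choose p\<close>, the form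
  \<open>b\<^bsub>n-p\<^esub>\<close> is the \<open>p\<close>-th coefficient of \<open>g\<close> in the Bernstein basis of degree \<open>n\<close> in \<open>x\<close>,
  and it tends to \<open>g(x, y, z)\<close> when \<open>p / n\<close> tends to \<open>x\<close>. If some coefficient were negative at a
  point of the circle for every \<open>N\<close>, then a limit point would be a zero of \<open>g\<close>, hence lie over
  \<open>x = 0\<close> or \<open>x = 1\<close>. Say \<open>x = 0\<close>. The coefficient for \<open>p = 0\<close> is \<open>g(0, y, z) \<ge> 0\<close>, so the
  coefficients must decrease somewhere before the negative one. Their differences are, up to the
  factor \<open>1 / n\<close>, Bernstein coefficients of \<open>\<partial>g / \<partial>x\<close>, so \<open>\<partial>g / \<partial>x \<le> 0\<close> at
  the limit point, whereas the hypotheses make it positive there.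
\<close>

section \<open>Evaluation of bivariate polynomials\<close>

lemma eval2_pCons: "eval2 (pCons a p) x y = poly a x + y * eval2 p x y"
  by (simp add: eval2_def spec_fst_def map_poly_pCons)

text \<open>Substituting a constant polynomial for the outer variable turns \<open>eval2\<close>
  into two ordinary evaluations, to which the standard rules for sums and products apply.\<close>

lemma eval2_conv_poly_poly: "eval2 p x y = poly (poly p [:y:]) x"
  by (induction p) (simp_all add: eval2_pCons, simp add: eval2_def spec_fst_def)

lemma eval2_altdef: "eval2 p x y = (\<Sum>i\<le>degree p. poly (coeff p i) x * y ^ i)"
  by (simp add: eval2_conv_poly_poly poly_altdef[of p] poly_sum)

lemma pderivX_pCons: "pderivX (pCons a p) = pCons (pderiv a) (pderivX p)"
  by (simp add: pderivX_def map_poly_pCons)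

lemma DERIV_eval2:
  "((\<lambda>x. eval2 f x y) has_real_derivative eval2 (pderivX f) x y) (at x)"
proof (induction f)
  case 0
  then show ?case by (simp add: eval2_def spec_fst_def pderivX_def)
next
  case (pCons a f)
  then show ?case
    unfolding eval2_pCons pderivX_pCons
    by (auto intro!: derivative_eq_intros poly_DERIV)
qed

lemma degree_coeff_le_degX: "i \<le> degree f \<Longrightarrow> degree (coeff f i) \<le> degX f"
  by (simp add: degX_def)

section \<open>Nonnegative univariate polynomials\<close>

lemma lead_coeff_pos_of_nonneg:
  fixes q :: "real poly"
  assumes "\<And>x. poly q x \<ge> 0" "q \<noteq> 0"
  shows "lead_coeff q > 0"
proof (rule ccontr)
  assume "\<not> ?thesis"
  then have "lead_coeff (- q) > 0"
    using assms(2) by (metis leading_coeff_0_iff lead_coeff_minus linorder_cases neg_0_less_iff_less)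
  from poly_pinfty_gt_lc[OF this] obtain t where "poly (- q) t \<ge> lead_coeff (- q)"
    by blast
  with \<open>lead_coeff (- q) > 0\<close> assms(1)[of t] show False by simp
qed

text \<open>The reflection \<open>q(-x)\<close> is nonnegative too, so its leading coefficient
  \<open>lead_coeff q * (-1) ^ degree q\<close> is positive, as is that of \<open>q\<close>.\<close>

lemma even_degree_of_nonneg:
  fixes q :: "real poly"
  assumes "\<And>x. poly q x \<ge> 0" "q \<noteq> 0"
  shows "even (degree q)"
proof -
  let ?r = "pcompose q [:0, -1:]"
  have lc: "lead_coeff ?r = lead_coeff q * (-1) ^ degree q"
    by (subst lead_coeff_comp) auto
  moreover have "lead_coeff q > 0" using lead_coeff_pos_of_nonneg assms .
  moreover have "lead_coeff ?r > 0"
  proof (rule lead_coeff_pos_of_nonneg)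
    show "?r \<noteq> 0" using lc assms(2) by (metis leading_coeff_0_iff mult_eq_0_iff power_eq_0_iff
      zero_neq_neg_one)
  qed (simp add: poly_pcompose assms)
  ultimately show ?thesis
    by (metis mult_minus_right mult.right_neutral neg_0_less_iff_less not_less_iff_gr_or_eq
        power_minus_odd power_one)
qed

section \<open>Homogenization in the second variable\<close>

definition hcoeff :: "real poly poly \<Rightarrow> nat \<Rightarrow> real \<Rightarrow> real \<Rightarrow> real" where
  "hcoeff f k y z = (\<Sum>i\<le>degree f. coeff (coeff f i) k * y ^ i * z ^ (degree f - i))"

definition heval :: "real poly poly \<Rightarrow> real \<Rightarrow> real \<Rightarrow> real \<Rightarrow> real" where
  "heval f x y z = (\<Sum>k\<le>degX f. hcoeff f k y z * x ^ k)"

text \<open>The formal derivative of \<open>heval\<close> in \<open>x\<close>. For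
  \<open>k = 0\<close> the factor \<open>real k\<close> removes the term, whatever the truncated
  exponent \<open>k - 1\<close> gives.\<close>

definition hderiv :: "real poly poly \<Rightarrow> real \<Rightarrow> real \<Rightarrow> real \<Rightarrow> real" where
  "hderiv f x y z = (\<Sum>k\<le>degX f. hcoeff f k y z * (real k * x ^ (k - 1)))"

lemma heval_altdef:
  "heval f x y z = (\<Sum>i\<le>degree f. poly (coeff f i) x * y ^ i * z ^ (degree f - i))"
proof -
  have "heval f x y z =
      (\<Sum>i\<le>degree f. \<Sum>k\<le>degX f. coeff (coeff f i) k * x ^ k * y ^ i * z ^ (degree f - i))"
    unfolding heval_def hcoeff_def sum_distrib_right
    by (subst sum.swap) (simp add: mult_ac)
  also have "\<dots> = (\<Sum>i\<le>degree f. poly (coeff f i) x * y ^ i * z ^ (degree f - i))"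
  proof (intro sum.cong refl)
    fix i assume "i \<in> {..degree f}"
    then have "poly (coeff f i) x = (\<Sum>k\<le>degX f. coeff (coeff f i) k * x ^ k)"
      unfolding poly_altdef
      by (intro sum.mono_neutral_left) (auto simp: degree_coeff_le_degX coeff_eq_0)
    then show "(\<Sum>k\<le>degX f. coeff (coeff f i) k * x ^ k * y ^ i * z ^ (degree f - i)) =
        poly (coeff f i) x * y ^ i * z ^ (degree f - i)"
      by (simp add: sum_distrib_right)
  qed
  finally show ?thesis .
qed

lemma heval_eq_eval2:
  assumes "z \<noteq> 0"
  shows "heval f x y z = z ^ degree f * eval2 f x (y / z)"
  unfolding heval_altdef eval2_altdef sum_distrib_left
proof (intro sum.cong refl)
  fix i assume "i \<in> {..degree f}"
  then have "z ^ degree f = z ^ i * z ^ (degree f - i)"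
    by (simp flip: power_add)
  then show "poly (coeff f i) x * y ^ i * z ^ (degree f - i) =
      z ^ degree f * (poly (coeff f i) x * (y / z) ^ i)"
    using assms by (simp add: power_divide)
qed

text \<open>These are the points at infinity, which \<open>eval2\<close> does not see. Only
  \<open>i = degree f\<close> survives, because \<open>0 ^ 0 = 1\<close>.\<close>

lemma heval_at_0: "heval f x y 0 = poly (lead_coeff f) x * y ^ degree f"
proof -
  have "heval f x y 0 = (\<Sum>i\<le>degree f. if i = degree f then poly (coeff f i) x * y ^ i else 0)"
    unfolding heval_altdef by (intro sum.cong) auto
  then show ?thesis by simp
qed

lemma DERIV_heval: "((\<lambda>x. heval f x y z) has_real_derivative hderiv f x y z) (at x)"
  unfolding heval_def hderiv_def by (auto intro!: derivative_eq_intros sum.cong)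

text \<open>Both sides are derivatives in \<open>x\<close> of the same function, which spares a
  second manipulation of sums.\<close>

lemma hderiv_eq_eval2:
  assumes "z \<noteq> 0"
  shows "hderiv f x y z = z ^ degree f * eval2 (pderivX f) x (y / z)"
proof (rule DERIV_unique[OF DERIV_heval])
  show "((\<lambda>x. heval f x y z) has_real_derivative z ^ degree f * eval2 (pderivX f) x (y / z)) (at x)"
    unfolding heval_eq_eval2[OF assms] by (intro DERIV_cmult DERIV_eval2)
qed

lemma tendsto_hcoeff:
  assumes "(y \<longlongrightarrow> a) F" "(z \<longlongrightarrow> b) F"
  shows "((\<lambda>i. hcoeff f k (y i) (z i)) \<longlongrightarrow> hcoeff f k a b) F"
  unfolding hcoeff_def by (intro tendsto_intros assms)

section \<open>Bernstein coefficients\<close>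

text \<open>The falling factorial. Real arguments allow \<open>real n - 1\<close> without
  truncation, and at \<open>real p\<close> with \<open>p < k\<close> the product vanishes.\<close>

definition ffact :: "nat \<Rightarrow> real \<Rightarrow> real" where
  "ffact k x = (\<Prod>l<k. x - real l)"

lemma ffact_Suc: "ffact (Suc k) x = ffact k x * (x - real k)"
  by (simp add: ffact_def)

lemma ffact_Suc_shift: "ffact (Suc k) x = x * ffact k (x - 1)"
  unfolding ffact_def by (simp only: prod.lessThan_Suc_shift) (simp add: algebra_simps)

text \<open>A discrete analogue of the derivative of \<open>x ^ k\<close>: for \<open>k > 0\<close>
  both values contain \<open>ffact (k - 1) x\<close>, with cofactors \<open>x + 1\<close> and
  \<open>x - (k - 1)\<close>.\<close>

lemma ffact_diff: "ffact k (x + 1) - ffact k x = real k * ffact (k - 1) x"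
  using ffact_Suc_shift[of "k - 1" "x + 1"] ffact_Suc[of "k - 1" x]
  by (cases k) (simp_all add: algebra_simps, simp add: ffact_def)

lemma ffact_0_right: "ffact k 0 = 0 ^ k"
  by (cases k) (simp_all add: ffact_Suc_shift, simp add: ffact_def)

lemma ffact_of_nat_pos: "k \<le> n \<Longrightarrow> ffact k (real n) > 0"
  unfolding ffact_def by (intro prod_pos) auto

text \<open>By absorption, lowering the upper index \<open>M\<close> by one multiplies
  \<open>M choose j\<close> by \<open>(M - j) / M\<close>. For \<open>M = n - k\<close> and
  \<open>j = n - p\<close> this ratio is the next factor \<open>(p - k) / (n - k)\<close> of the
  quotient.\<close>

lemma binomial_eq_ffact:
  assumes "k \<le> n" "p \<le> n"
  shows "real ((n - k) choose (n - p)) = real (n choose p) * (ffact k (real p) / ffact k (real n))"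
  using assms(1)
proof (induction k)
  case 0
  then show ?case using assms(2) by (simp add: ffact_def binomial_symmetric[symmetric])
next
  case (Suc k)
  let ?M = "n - k" and ?j = "n - p"
  have "(?M - ?j) * (?M choose ?j) = ?M * ((?M - 1) choose ?j)"
    by (rule binomial_absorb_comp)
  then have "real (?M - ?j) * real (?M choose ?j) = real ?M * real ((n - Suc k) choose ?j)"
    by (metis of_nat_mult diff_Suc_eq_diff_pred diff_commute diff_diff_left plus_1_eq_Suc
        add.commute)
  \<comment> \<open>If \<open>?j > ?M\<close>, the subtraction is truncated, but then the binomial
    coefficient is 0 on both sides.\<close>
  moreover have "real (?M - ?j) * real (?M choose ?j) = (real p - real k) * real (?M choose ?j)"
    using assms(2) Suc.prems by (cases "?j \<le> ?M") (simp_all add: of_nat_diff)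
  ultimately have "real ((n - Suc k) choose ?j) =
      (real p - real k) * real (?M choose ?j) / (real n - real k)"
    using Suc.prems by (simp add: field_simps of_nat_diff)
  then show ?case using Suc by (simp add: ffact_Suc)
qed

text \<open>Divide numerator and denominator of each of the \<open>k\<close> factors by
  \<open>n i\<close>; every factor then tends to \<open>x\<close>. The shift \<open>c\<close> is 0
  for \<open>bern\<close> and 1 for \<open>bern_deriv\<close>.\<close>

lemma tendsto_ffact_quotient:
  fixes n p :: "nat \<Rightarrow> real"
  assumes "filterlim n at_top sequentially" "(\<lambda>i. p i / n i) \<longlonglongrightarrow> x"
  shows "(\<lambda>i. ffact k (p i) / ffact k (n i - c)) \<longlonglongrightarrow> x ^ k"
proof -
  have inv: "(\<lambda>i. b / n i) \<longlonglongrightarrow> 0" for b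
    by (rule real_tendsto_divide_at_top[OF tendsto_const assms(1)])
  have "(\<lambda>i. (p i - real l) / (n i - c - real l)) \<longlonglongrightarrow> x" for l
  proof -
    have "(\<lambda>i. (p i / n i - real l / n i) / (1 - (c + real l) / n i)) \<longlonglongrightarrow> (x - 0) / (1 - 0)"
      by (intro tendsto_intros assms inv) simp
    moreover have "\<forall>\<^sub>F i in sequentially. n i > 0"
      using assms(1) by (rule eventually_compose_filterlim[rotated]) (rule eventually_gt_at_top)
    then have "\<forall>\<^sub>F i in sequentially. (p i / n i - real l / n i) / (1 - (c + real l) / n i) =
        (p i - real l) / (n i - c - real l)"
    proof eventually_elim
      case (elim i)
      have "p i / n i - real l / n i = (p i - real l) / n i"
        "1 - (c + real l) / n i = (n i - c - real l) / n i"
        using elim by (simp_all add: field_simps)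
      then show ?case using elim by simp
    qed
    ultimately show ?thesis by (simp add: tendsto_cong)
  qed
  then have "(\<lambda>i. \<Prod>l<k. (p i - real l) / (n i - c - real l)) \<longlonglongrightarrow> (\<Prod>l<k. x)"
    by (intro tendsto_prod)
  then show ?thesis by (simp add: ffact_def prod_dividef)
qed

text \<open>For \<open>k \<le> n\<close>, the monomial \<open>x ^ k\<close> has
  \<open>ffact k p / ffact k n\<close> as its \<open>p\<close>-th Bernstein coefficient in degree
  \<open>n\<close>; the sum extends this linearly.\<close>

definition bern :: "real poly poly \<Rightarrow> nat \<Rightarrow> nat \<Rightarrow> real \<Rightarrow> real \<Rightarrow> real" where
  "bern f n p y z = (\<Sum>k\<le>degX f. hcoeff f k y z * (ffact k (real p) / ffact k (real n)))"

text \<open>The same expression for the derivative in \<open>x\<close>, in degree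
  \<open>n - 1\<close>.\<close>

definition bern_deriv :: "real poly poly \<Rightarrow> nat \<Rightarrow> nat \<Rightarrow> real \<Rightarrow> real \<Rightarrow> real" where
  "bern_deriv f n p y z = (\<Sum>k\<le>degX f.
     hcoeff f k y z * (real k * (ffact (k - 1) (real p) / ffact (k - 1) (real n - 1))))"

lemma bern_0: "bern f n 0 y z = heval f 0 y z"
proof -
  have "ffact k 0 / ffact k (real n) = 0 ^ k" for k
    by (cases k) (simp_all add: ffact_0_right, simp add: ffact_def)
  then show ?thesis by (simp add: bern_def heval_def)
qed

text \<open>The bound on \<open>degX f\<close> keeps \<open>ffact k n\<close> nonzero, so every
  quotient is 1 and not \<open>0 / 0 = 0\<close>.\<close>

lemma bern_self:
  assumes "degX f \<le> n"
  shows "bern f n n y z = heval f 1 y z"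
  unfolding bern_def heval_def
  using ffact_of_nat_pos[of _ n] assms by (intro sum.cong) (auto simp: less_imp_neq[symmetric])

text \<open>Termwise this is \<open>ffact_diff\<close>; the factor \<open>n\<close> cancels against
  \<open>ffact k n = n * ffact (k - 1) (n - 1)\<close>.\<close>

lemma bern_diff: "real n * (bern f n (Suc p) y z - bern f n p y z) = bern_deriv f n p y z"
  if "n > 0"
proof -
  have *: "real n * (ffact k (real (Suc p)) / ffact k (real n) - ffact k (real p) / ffact k (real n)) =
      real k * (ffact (k - 1) (real p) / ffact (k - 1) (real n - 1))" for k
  proof (cases k)
    case (Suc l)
    have "ffact k (real (Suc p)) - ffact k (real p) = real k * ffact (k - 1) (real p)"
      using ffact_diff[of k "real p"] by (simp add: add.commute)
    then show ?thesis
      using that Suc by (simp add: ffact_Suc_shift[of l "real n"] flip: diff_divide_distrib)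
  qed (simp add: ffact_def)
  have "real n * (bern f n (Suc p) y z - bern f n p y z) = (\<Sum>k\<le>degX f. hcoeff f k y z *
      (real n * (ffact k (real (Suc p)) / ffact k (real n) - ffact k (real p) / ffact k (real n))))"
    unfolding bern_def by (simp add: sum_distrib_left sum_subtractf algebra_simps)
  then show ?thesis by (simp only: * bern_deriv_def)
qed

lemma tendsto_bern:
  assumes "filterlim (\<lambda>i. real (n i)) at_top sequentially" "(\<lambda>i. real (p i) / real (n i)) \<longlonglongrightarrow> x"
    "y \<longlonglongrightarrow> a" "z \<longlonglongrightarrow> b"
  shows "(\<lambda>i. bern f (n i) (p i) (y i) (z i)) \<longlonglongrightarrow> heval f x a b"
  unfolding bern_def heval_def
  using tendsto_ffact_quotient[OF assms(1,2), where c = 0]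
  by (intro tendsto_sum tendsto_mult tendsto_hcoeff assms) simp

lemma tendsto_bern_deriv:
  assumes "filterlim (\<lambda>i. real (n i)) at_top sequentially" "(\<lambda>i. real (p i) / real (n i)) \<longlonglongrightarrow> x"
    "y \<longlonglongrightarrow> a" "z \<longlonglongrightarrow> b"
  shows "(\<lambda>i. bern_deriv f (n i) (p i) (y i) (z i)) \<longlonglongrightarrow> hderiv f x a b"
  unfolding bern_deriv_def hderiv_def
  by (intro tendsto_sum tendsto_mult tendsto_hcoeff tendsto_const tendsto_ffact_quotient assms)

section \<open>The forms \<open>b_poly\<close> in terms of Bernstein coefficients\<close>

lemma coeff_varW_varX_power:
  assumes "k \<le> n" "j \<le> n"
  shows "coeff (coeff (varX ^ k * (varW + varX) ^ (n - k)) j) (n - j) = of_nat ((n - k) choose j)"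
proof -
  have mon: "varX ^ k * (of_nat c * varW ^ l * varX ^ (n - k - l)) =
      monom (monom (of_nat c) (k + (n - k - l))) l" for c l
  proof -
    have "varX ^ (k + (n - k - l)) = [:monom 1 (k + (n - k - l)):]"
      by (simp add: varX_def poly_const_pow monom_altdef)
    moreover have "varW ^ l = monom 1 l"
      by (simp add: varW_def monom_altdef)
    moreover have "(of_nat c :: poly4) = [:[:of_nat c:]:]"
      by (simp add: of_nat_poly)
    moreover have "varX ^ k * (of_nat c * varW ^ l * varX ^ (n - k - l)) =
        of_nat c * (varW ^ l * varX ^ (k + (n - k - l)))"
      by (simp add: power_add mult_ac)
    ultimately show ?thesis by (simp add: smult_monom)
  qed
  have "varX ^ k * (varW + varX) ^ (n - k) =
      (\<Sum>l\<le>n - k. monom (monom (of_nat ((n - k) choose l)) (k + (n - k - l))) l)"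
    unfolding binomial_ring sum_distrib_left mon ..
  also have "coeff (coeff \<dots> j) (n - j) =
      (\<Sum>l\<le>n - k. if l = j then of_nat ((n - k) choose j) else 0)"
    unfolding coeff_sum using assms by (intro sum.cong) auto
  also have "\<dots> = of_nat ((n - k) choose j)"
    using assms by (auto simp: binomial_eq_0)
  finally show ?thesis .
qed

text \<open>The factor \<open>(W + X) ^ N\<close> merges with \<open>(W + X) ^ (d - k)\<close> into
  \<open>(W + X) ^ (n - k)\<close>, whose expansion supplies the binomial coefficients.\<close>

lemma eval2_b_poly:
  assumes "j \<le> N + degX f"
  shows "eval2 (b_poly N f j) y z =
    (\<Sum>k\<le>degX f. hcoeff f k y z * real ((N + degX f - k) choose j))"
proof -
  define n where "n = N + degX f"
  \<comment> \<open>The part of a summand that involves only \<open>Y\<close> (inner) and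
    \<open>Z\<close> (outer).\<close>
  define e where "e i k = [:[:coeff (coeff f i) k:]:] * [:[:0, 1:]:] ^ i * [:0, 1:] ^ (degree f - i)"
    for i k
  have split: "(varW + varX) ^ N * (const4 (coeff (coeff f i) k) * varX ^ k *
      (varW + varX) ^ (degX f - k) * varY ^ i * varZ ^ (degree f - i)) =
      [:[:e i k:]:] * (varX ^ k * (varW + varX) ^ (n - k))" if "k \<le> degX f" for i k
  proof -
    have "(varW + varX) ^ (n - k) = (varW + varX) ^ N * (varW + varX) ^ (degX f - k)"
      using that by (simp add: n_def flip: power_add)
    moreover have "[:[:e i k:]:] = const4 (coeff (coeff f i) k) * varY ^ i * varZ ^ (degree f - i)"
      by (simp add: e_def const4_def varY_def varZ_def poly_const_pow)
    ultimately show ?thesis by (simp only: mult_ac)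
  qed
  have "(varW + varX) ^ N * homogF f = (\<Sum>i\<le>degree f. \<Sum>k\<le>degX f.
      [:[:e i k:]:] * (varX ^ k * (varW + varX) ^ (n - k)))"
    unfolding homogF_def sum_distrib_left by (intro sum.cong refl split) simp
  then have "b_poly N f j = (\<Sum>i\<le>degree f. \<Sum>k\<le>degX f.
      e i k * coeff (coeff (varX ^ k * (varW + varX) ^ (n - k)) j) (n - j))"
    unfolding b_poly_def n_def[symmetric] by (simp add: coeff_sum)
  also have "\<dots> = (\<Sum>i\<le>degree f. \<Sum>k\<le>degX f. e i k * of_nat ((n - k) choose j))"
    using assms by (intro sum.cong refl) (simp add: coeff_varW_varX_power n_def)
  finally have "eval2 (b_poly N f j) y z = (\<Sum>i\<le>degree f. \<Sum>k\<le>degX f.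
      coeff (coeff f i) k * y ^ i * z ^ (degree f - i) * real ((n - k) choose j))"
    by (simp add: eval2_conv_poly_poly poly_sum e_def mult_ac)
  also have "\<dots> = (\<Sum>k\<le>degX f. hcoeff f k y z * real ((n - k) choose j))"
    unfolding hcoeff_def sum_distrib_right by (rule sum.swap)
  finally show ?thesis by (simp add: n_def)
qed

lemma eval2_b_poly_eq_bern:
  assumes "j \<le> N + degX f"
  shows "eval2 (b_poly N f j) y z = real ((N + degX f) choose j) *
    bern f (N + degX f) (N + degX f - j) y z"
proof -
  define n where "n = N + degX f"
  have "real ((n - k) choose j) =
      real (n choose j) * (ffact k (real (n - j)) / ffact k (real n))" if "k \<le> degX f" for k
    using binomial_eq_ffact[of k n "n - j"] that assms
    by (simp add: n_def binomial_symmetric[of j])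
  then show ?thesis
    unfolding eval2_b_poly[OF assms] bern_def n_def[symmetric] sum_distrib_left
    by (intro sum.cong) (auto simp: mult_ac)
qed

section \<open>The limiting argument\<close>

lemma ex_descent:
  fixes B :: "nat \<Rightarrow> real"
  assumes "a \<le> b" "B b < B a"
  shows "\<exists>q. a \<le> q \<and> q < b \<and> B (Suc q) < B q"
proof (rule ccontr)
  assume "\<not> ?thesis"
  then have step: "B q \<le> B (Suc q)" if "a \<le> q" "q < b" for q
    using that by (auto simp: not_less)
  have "q \<le> b \<longrightarrow> B a \<le> B q" if "a \<le> q" for q
    using that by (induction q rule: dec_induct) (auto dest: step intro: order_trans)
  then have "B a \<le> B b" using assms(1) by blast
  with assms(2) show False by simp
qed

lemma ex_bern_nonneg:
  assumes nonneg: "\<And>x y z. 0 \<le> x \<Longrightarrow> x \<le> 1 \<Longrightarrow> y\<^sup>2 + z\<^sup>2 = 1 \<Longrightarrow> heval f x y z \<ge> 0"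
    and zero: "\<And>x y z. 0 \<le> x \<Longrightarrow> x \<le> 1 \<Longrightarrow> y\<^sup>2 + z\<^sup>2 = 1 \<Longrightarrow> heval f x y z = 0 \<Longrightarrow> x = 0 \<or> x = 1"
    and pos: "\<And>y z. y\<^sup>2 + z\<^sup>2 = 1 \<Longrightarrow> heval f 0 y z = 0 \<Longrightarrow> hderiv f 0 y z > 0"
    and neg: "\<And>y z. y\<^sup>2 + z\<^sup>2 = 1 \<Longrightarrow> heval f 1 y z = 0 \<Longrightarrow> hderiv f 1 y z < 0"
  shows "\<exists>N. \<forall>p\<le>N + degX f. \<forall>y z. y\<^sup>2 + z\<^sup>2 = 1 \<longrightarrow> bern f (N + degX f) p y z \<ge> 0"
proof (rule ccontr)
  assume "\<not> ?thesis"
  then have "\<forall>N. \<exists>p y z. p \<le> N + degX f \<and> y\<^sup>2 + z\<^sup>2 = 1 \<and> bern f (N + degX f) p y z < 0"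
    by (auto simp: not_le)
  then obtain p0 y0 z0 where bad: "\<And>N. p0 N \<le> N + degX f" "\<And>N. (y0 N)\<^sup>2 + (z0 N)\<^sup>2 = 1"
      "\<And>N. bern f (N + degX f) (p0 N) (y0 N) (z0 N) < 0"
    by metis
  \<comment> \<open>Packing the ratio and the circle point into one sequence in a compact box lets a
    single subsequence serve for all three limits. If \<open>N + degX f = 0\<close>, the ratio is
    \<open>0 / 0 = 0\<close>, still in the box.\<close>
  define s where "s N = (real (p0 N) / real (N + degX f), y0 N, z0 N)" for N
  have "s N \<in> {0..1} \<times> {-1..1} \<times> {-1..1}" for N
  proof -
    have "real (p0 N) / real (N + degX f) \<in> {0..1}"
      using bad(1)[of N] by (auto simp: divide_le_eq_1 simp del: of_nat_add)
    moreover have "(y0 N)\<^sup>2 \<le> 1" "(z0 N)\<^sup>2 \<le> 1"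
      using bad(2)[of N] zero_le_power2[of "y0 N"] zero_le_power2[of "z0 N"] by linarith+
    then have "y0 N \<in> {-1..1}" "z0 N \<in> {-1..1}"
      by (auto simp: abs_square_le_1 abs_le_iff)
    ultimately show ?thesis by (simp add: s_def)
  qed
  moreover have "compact ({0..1::real} \<times> {-1..1::real} \<times> {-1..1::real})"
    by (intro compact_Times compact_Icc)
  ultimately obtain l r where l: "l \<in> {0..1} \<times> {-1..1} \<times> {-1..1}" and r: "strict_mono r"
      and lim: "(s \<circ> r) \<longlonglongrightarrow> l"
    unfolding compact_def by metis
  obtain x a b where xab: "l = (x, a, b)" by (cases l)
  define n where "n i = r i + degX f" for i
  define p where "p i = p0 (r i)" for i
  define y where "y i = y0 (r i)" for i
  define z where "z i = z0 (r i)" for i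
  have x: "0 \<le> x" "x \<le> 1" using l xab by auto
  have px: "(\<lambda>i. real (p i) / real (n i)) \<longlonglongrightarrow> x" and y: "y \<longlonglongrightarrow> a" and z: "z \<longlonglongrightarrow> b"
    using tendsto_fst[OF lim] tendsto_fst[OF tendsto_snd[OF lim]] tendsto_snd[OF tendsto_snd[OF lim]]
    by (simp_all add: s_def xab n_def p_def y_def[abs_def] z_def[abs_def] comp_def)
  \<comment> \<open>This gives both that \<open>n\<close> tends to infinity and that it is
    eventually positive, as \<open>bern_diff\<close> requires.\<close>
  have n_ge: "i \<le> n i" for i
    using strict_mono_imp_increasing[OF r] by (auto simp: n_def intro: trans_le_add1)
  have n: "filterlim (\<lambda>i. real (n i)) at_top sequentially"
    by (rule filterlim_at_top_mono[OF filterlim_real_sequentially])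
      (use n_ge in \<open>auto intro!: always_eventually\<close>)
  have n_pos: "\<forall>\<^sub>F i in sequentially. n i > 0"
    using eventually_gt_at_top[of 0]
    by eventually_elim (use n_ge in \<open>blast intro: less_le_trans\<close>)
  have circ: "(y i)\<^sup>2 + (z i)\<^sup>2 = 1" and p_le: "p i \<le> n i"
    and bern_neg: "bern f (n i) (p i) (y i) (z i) < 0" for i
    using bad[of "r i"] by (simp_all add: y_def z_def p_def n_def)
  have "(\<lambda>i. (y i)\<^sup>2 + (z i)\<^sup>2) \<longlonglongrightarrow> a\<^sup>2 + b\<^sup>2"
    by (intro tendsto_intros y z)
  then have ab: "a\<^sup>2 + b\<^sup>2 = 1" by (simp add: circ LIMSEQ_const_iff)
  have "heval f x a b \<le> 0"
    using tendsto_bern[OF n px y z, of f]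
    by (rule tendsto_upperbound) (use bern_neg in \<open>auto simp: less_imp_le\<close>)
  then have hz: "heval f x a b = 0" using nonneg[OF x ab] by simp
  from zero[OF x ab hz] show False
  proof
    assume "x = 0"
    have "\<exists>q. q < p i \<and> bern f (n i) (Suc q) (y i) (z i) < bern f (n i) q (y i) (z i)" for i
    proof -
      have "bern f (n i) 0 (y i) (z i) \<ge> 0" using nonneg[OF _ _ circ] by (simp add: bern_0)
      then show ?thesis
        using ex_descent[of 0 "p i" "\<lambda>q. bern f (n i) q (y i) (z i)"] bern_neg[of i] by force
    qed
    then obtain q where q: "\<And>i. q i < p i"
        "\<And>i. bern f (n i) (Suc (q i)) (y i) (z i) < bern f (n i) (q i) (y i) (z i)"
      by metis
    have "(\<lambda>i. real (q i) / real (n i)) \<longlonglongrightarrow> 0"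
    proof (rule tendsto_sandwich[OF _ _ tendsto_const])
      show "(\<lambda>i. real (p i) / real (n i)) \<longlonglongrightarrow> 0" using px \<open>x = 0\<close> by simp
    qed (use q(1) in \<open>auto intro!: always_eventually divide_right_mono simp: less_imp_le\<close>)
    then have "(\<lambda>i. bern_deriv f (n i) (q i) (y i) (z i)) \<longlonglongrightarrow> hderiv f 0 a b"
      by (rule tendsto_bern_deriv[OF n _ y z])
    moreover have "\<forall>\<^sub>F i in sequentially. bern_deriv f (n i) (q i) (y i) (z i) \<le> 0"
      using n_pos by eventually_elim
        (use q(2) in \<open>auto simp: mult_le_0_iff less_imp_le simp flip: bern_diff\<close>)
    ultimately have "hderiv f 0 a b \<le> 0" by (intro tendsto_upperbound) auto
    with pos[OF ab] hz \<open>x = 0\<close> show False by simp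
  next
    assume "x = 1"
    \<comment> \<open>Mirror image of the case \<open>x = 0\<close>: the coefficients must rise
      between the negative one at \<open>p i\<close> and the nonnegative one at \<open>n i\<close>,
      so the descent is applied to their negatives.\<close>
    have "\<exists>q. p i \<le> q \<and> q < n i \<and> bern f (n i) q (y i) (z i) < bern f (n i) (Suc q) (y i) (z i)" for i
    proof -
      have "bern f (n i) (n i) (y i) (z i) \<ge> 0"
        using nonneg[OF _ _ circ] by (subst bern_self) (simp_all add: n_def)
      then show ?thesis
        using ex_descent[of "p i" "n i" "\<lambda>q. - bern f (n i) q (y i) (z i)"] bern_neg[of i] p_le[of i]
        by force
    qed
    then obtain q where q: "\<And>i. p i \<le> q i" "\<And>i. q i < n i"
        "\<And>i. bern f (n i) (q i) (y i) (z i) < bern f (n i) (Suc (q i)) (y i) (z i)"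
      by metis
    have "(\<lambda>i. real (q i) / real (n i)) \<longlonglongrightarrow> 1"
    proof (rule tendsto_sandwich[OF _ _ _ tendsto_const])
      show "(\<lambda>i. real (p i) / real (n i)) \<longlonglongrightarrow> 1" using px \<open>x = 1\<close> by simp
    qed (use q(1,2) in \<open>auto intro!: always_eventually divide_right_mono simp: less_imp_le
          divide_le_eq_1\<close>)
    then have "(\<lambda>i. bern_deriv f (n i) (q i) (y i) (z i)) \<longlonglongrightarrow> hderiv f 1 a b"
      by (rule tendsto_bern_deriv[OF n _ y z])
    moreover have "\<forall>\<^sub>F i in sequentially. bern_deriv f (n i) (q i) (y i) (z i) \<ge> 0"
      using n_pos by eventually_elim
        (use q(3) in \<open>auto simp: less_imp_le simp flip: bern_diff\<close>)
    ultimately have "hderiv f 1 a b \<ge> 0" by (intro tendsto_lowerbound) auto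
    with neg[OF ab] hz \<open>x = 1\<close> show False by simp
  qed
qed

section \<open>From \<open>f\<close> on the strip to its homogenization on the circle\<close>

theorem proposition18:
  fixes f :: "real poly poly" and m d :: nat
  assumes "m = degree f"
    and "d = degX f"
    and "\<forall>x\<in>{0..1}. \<forall>y. eval2 f x y \<ge> 0"
    and "fully_ic_on m f {0..1}"
    and "finite {(x, y). x \<in> {0..1} \<and> eval2 f x y = 0}"
    and "\<forall>x\<in>{0..1}. \<forall>y. eval2 f x y = 0 \<longrightarrow> x \<in> {0, 1}"
    and "\<forall>x\<in>{0..1}. \<forall>y. eval2 f x y = 0 \<longrightarrow> eval2 (pderivX f) x y \<noteq> 0"
  shows "\<exists>N. \<forall>j\<le>N + d. \<forall>(y, z)\<in>unit_circle. eval2 (b_poly N f j) y z \<ge> 0"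
proof -
  have nonneg: "eval2 f x y \<ge> 0" if "0 \<le> x" "x \<le> 1" for x y
    using assms(3) that by simp
  have spec: "spec_fst f x \<noteq> 0" "degree (spec_fst f x) = degree f" if "0 \<le> x" "x \<le> 1" for x
    using assms(1,4) that by (simp_all add: fully_ic_on_def)
  have spec_nonneg: "poly (spec_fst f x) y \<ge> 0" if "0 \<le> x" "x \<le> 1" for x y
    using nonneg[OF that] by (simp add: eval2_def)
  have ev: "even (degree f)"
    using even_degree_of_nonneg[OF spec_nonneg spec(1), of 0] spec(2)[of 0] by simp
  \<comment> \<open>As \<open>spec_fst f x\<close> has the full degree, its leading coefficient is
    \<open>lead_coeff f\<close> evaluated at \<open>x\<close>.\<close>
  have lc: "poly (lead_coeff f) x > 0" if "0 \<le> x" "x \<le> 1" for x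
    using lead_coeff_pos_of_nonneg[OF spec_nonneg spec(1), OF that that] spec(2)[OF that]
    by (simp add: spec_fst_def coeff_map_poly)
  \<comment> \<open>Even degree makes the homogenizing factor positive for negative \<open>z\<close>
    too, so it preserves signs.\<close>
  have zpos: "z ^ degree f > 0" if "z \<noteq> 0" for z :: real
    using ev that by (simp add: zero_less_power_eq)
  have at0: "heval f x y 0 > 0" if "0 \<le> x" "x \<le> 1" "y\<^sup>2 + 0\<^sup>2 = 1" for x y
    using lc[OF that(1,2)] zpos[of y] that(3) by (cases "y = 0") (auto simp: heval_at_0)
  \<comment> \<open>There are no zeros at infinity: each zero of \<open>heval\<close> on the circle
    comes from the zero \<open>y / z\<close> of \<open>eval2 f x\<close>.\<close>
  have z_nz: "z \<noteq> 0" if "0 \<le> x" "x \<le> 1" "y\<^sup>2 + z\<^sup>2 = 1" "heval f x y z = 0" for x y z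
    using at0[of x y] that by auto
  have "\<exists>N. \<forall>p\<le>N + degX f. \<forall>y z. y\<^sup>2 + z\<^sup>2 = 1 \<longrightarrow> bern f (N + degX f) p y z \<ge> 0"
  proof (rule ex_bern_nonneg)
    fix x y z :: real assume *: "0 \<le> x" "x \<le> 1" "y\<^sup>2 + z\<^sup>2 = 1"
    show "heval f x y z \<ge> 0"
    proof (cases "z = 0")
      case True
      then show ?thesis using at0 * by (simp add: less_imp_le)
    next
      case False
      then show ?thesis using zpos[OF False] nonneg[OF *(1,2)]
        by (simp add: heval_eq_eval2 less_imp_le)
    qed
    assume "heval f x y z = 0"
    with z_nz[OF * this] show "x = 0 \<or> x = 1"
      using assms(6) * by (auto simp: heval_eq_eval2)
  next
    fix y z :: real assume *: "y\<^sup>2 + z\<^sup>2 = 1" "heval f 0 y z = 0"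
    then have z: "z \<noteq> 0" using z_nz[of 0] by simp
    with * have zero: "eval2 f 0 (y / z) = 0" by (simp add: heval_eq_eval2)
    \<comment> \<open>A negative derivative at a zero on the left edge would make \<open>f\<close>
      negative just to the right, inside the strip.\<close>
    have "\<not> eval2 (pderivX f) 0 (y / z) < 0"
    proof
      assume "eval2 (pderivX f) 0 (y / z) < 0"
      from DERIV_neg_dec_right[OF DERIV_eval2 this] obtain e where
        "e > 0" and e: "\<And>h. 0 < h \<Longrightarrow> h < e \<Longrightarrow> eval2 f h (y / z) < 0" by (auto simp: zero)
      \<comment> \<open>The minimum with 1 keeps \<open>h\<close> in the unit interval; halving
        \<open>e\<close> keeps it below \<open>e\<close>.\<close>
      moreover define h where "h = min 1 (e / 2)"
      ultimately have "0 < h" "h < e" "h \<le> 1" by auto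
      then show False using e[of h] nonneg[of h "y / z"] by simp
    qed
    moreover have "eval2 (pderivX f) 0 (y / z) \<noteq> 0" using assms(7) zero by simp
    ultimately show "hderiv f 0 y z > 0" using zpos[OF z] by (simp add: hderiv_eq_eval2 z)
  next
    fix y z :: real assume *: "y\<^sup>2 + z\<^sup>2 = 1" "heval f 1 y z = 0"
    then have z: "z \<noteq> 0" using z_nz[of 1] by simp
    with * have zero: "eval2 f 1 (y / z) = 0" by (simp add: heval_eq_eval2)
    \<comment> \<open>On the right edge the strip lies to the left, so the sign is reversed.\<close>
    have "\<not> eval2 (pderivX f) 1 (y / z) > 0"
    proof
      assume "eval2 (pderivX f) 1 (y / z) > 0"
      from DERIV_pos_inc_left[OF DERIV_eval2 this] obtain e where
        "e > 0" and e: "\<And>h. 0 < h \<Longrightarrow> h < e \<Longrightarrow> eval2 f (1 - h) (y / z) < 0" by (auto simp: zero)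
      moreover define h where "h = min 1 (e / 2)"
      ultimately have "0 < h" "h < e" "h \<le> 1" by auto
      then show False using e[of h] nonneg[of "1 - h" "y / z"] by simp
    qed
    moreover have "eval2 (pderivX f) 1 (y / z) \<noteq> 0" using assms(7) zero by simp
    ultimately show "hderiv f 1 y z < 0"
      using zpos[OF z] by (simp add: hderiv_eq_eval2 z mult_less_0_iff)
  qed
  then obtain N where "\<forall>p\<le>N + degX f. \<forall>y z. y\<^sup>2 + z\<^sup>2 = 1 \<longrightarrow> bern f (N + degX f) p y z \<ge> 0" ..
  \<comment> \<open>Nonnegativity at \<open>p = N + d - j\<close> carries over, since the binomial
    factor is nonnegative.\<close>
  then show ?thesis
    by (intro exI[of _ N]) (auto simp: assms(2) unit_circle_def eval2_b_poly_eq_bern)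
qed

end
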